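(* Let $R$ be an integral domain of characteristic $p$ with $p\in\{2,3\}$, and let $D=f(x_1)\partial_1$ be a nonzero derivation of $R[x_1]$, where $f(x_1)\in R[x_1]$. Then $D$ is locally nilpotent if and only if one of the following holds: (i) $f(x_1)=x_1^r\tilde{g}(x_1^p)$ for some $r\in\{0,1,\ldots,p-1\}$ with $r\neq 1$ and some $\tilde{g}(x_1^p)\in R[x_1^p]$; or (ii) $p=3$ and $f(x_1)=x_1^2f_2(x_1^3)+x_1f_1(x_1^3)+f_0(x_1^3)$ for some $f_2,f_1,f_0\in R[x_1^3]$ with $f_2f_1f_0\neq 0$ and $f_2f_0=f_1^2$.
   Context: $\partial_1=\frac{\partial}{\partial x_1}$. An $R$-linear endomorphism $\eta$ of $R[x_1]$ is locally nilpotent if for each $a\in R[x_1]$ there exists $m\geq1$ with $\eta^m(a)=0$. *)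

theory Defs
  imports "HOL-Computational_Algebra.Polynomial"
begin

(* For R-linear eta; f_pderiv_module_hom shows that the operators f * d/dx are linear. *)
definition locally_nilpotent :: "('a::comm_ring_1 poly \<Rightarrow> 'a poly) \<Rightarrow> bool" where
  "locally_nilpotent \<eta> \<longleftrightarrow> (\<forall>a. \<exists>m\<ge>1. (\<eta> ^^ m) a = 0)"

(* The subring R[x^n] of R[x]: its elements are the g(x^n) with g in R[x]. *)
definition poly_in_power :: "nat \<Rightarrow> 'a::comm_ring_1 poly set" where
  "poly_in_power n = {pcompose g ([:0, 1:] ^ n) | g. True}"

lemma f_pderiv_module_hom:
  fixes f :: "'a::idom poly"
  shows "module_hom smult smult (\<lambda>a. f * pderiv a)"
  by unfold_locales
    (simp_all add: pderiv_add pderiv_smult algebra_simps smult_add_right smult_add_left)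

lemma f_pderiv_Leibniz:
  fixes f :: "'a::idom poly"
  shows "f * pderiv (a * b) = a * (f * pderiv b) + (f * pderiv a) * b"
  by (simp add: pderiv_mult algebra_simps)

end

theory Submission
  imports Defs
begin

text \<open>
  Let \<open>X\<close> be the variable.  Every polynomial is \<open>f = f\<^sub>0 + X f\<^sub>1 + \<dots> + X\<^sup>p\<^sup>-\<^sup>1 f\<^sub>p\<^sub>-\<^sub>1\<close> with
  \<open>f\<^sub>i\<close> in \<open>R[X\<^sup>p]\<close>, and in characteristic \<open>p\<close> the \<open>f\<^sub>i\<close> are constants of the derivation
  \<open>D = f \<partial>\<close>.  Also in characteristic \<open>p\<close>, \<open>D\<^sup>p\<close> is again a derivation, so it is determined by
  \<open>D\<^sup>p X\<close>.  For \<open>p = 2\<close> and \<open>p = 3\<close> this value is a multiple \<open>c f\<close> with \<open>c\<close> a constant: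
  \<open>c = f\<^sub>1\<close> for \<open>p = 2\<close>, and \<open>c = f\<^sub>1\<^sup>2 - f\<^sub>2 f\<^sub>0\<close>, the discriminant of the quadratic \<open>f\<close>
  (as \<open>4 = 1\<close>), for \<open>p = 3\<close>.  Hence \<open>D\<^sup>p = c D\<close> (lemmas \<open>derivation_square_char_2\<close> and
  \<open>derivation_cube_char_3\<close>).  Iterating gives \<open>D\<^sup>k\<^sup>(\<^sup>p\<^sup>-\<^sup>1\<^sup>)\<^sup>+\<^sup>1 = c\<^sup>k D\<close>, and over a domain with
  \<open>D \<noteq> 0\<close> this vanishes at \<open>X\<close> only if \<open>c = 0\<close>.  So \<open>D\<close> is locally nilpotent exactly when
  \<open>c = 0\<close> (lemma \<open>locally_nilpotent_iff_factor_zero\<close>).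

  For \<open>p = 2\<close> the condition \<open>f\<^sub>1 = 0\<close> is the case \<open>r = 0\<close>.  For \<open>p = 3\<close> the condition is
  \<open>f\<^sub>2 f\<^sub>0 = f\<^sub>1\<^sup>2\<close>: if some \<open>f\<^sub>i\<close> vanishes, then \<open>f\<^sub>1\<close> and one of \<open>f\<^sub>0, f\<^sub>2\<close> do, which is
  \<open>f = X\<^sup>2 f\<^sub>2\<close> or \<open>f = f\<^sub>0\<close>; otherwise all three are nonzero.
\<close>

section \<open>Decomposition by exponents modulo \<open>n\<close>\<close>

lemma pcompose_in_poly_in_power: "pcompose g ([:0, 1:] ^ n) \<in> poly_in_power n"
  unfolding poly_in_power_def by blast

lemma zero_in_poly_in_power: "0 \<in> poly_in_power n"
  using pcompose_in_poly_in_power[of 0 n] by simp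

lemma pCons_power_in_poly_in_power:
  assumes "g \<in> poly_in_power n"
  shows "[:a:] + [:0, 1:] ^ n * g \<in> poly_in_power n"
proof -
  obtain h where "g = pcompose h ([:0, 1:] ^ n)"
    using assms unfolding poly_in_power_def by blast
  then have "[:a:] + [:0, 1:] ^ n * g = pcompose (pCons a h) ([:0, 1:] ^ n)"
    by (simp add: pcompose_pCons)
  then show ?thesis
    using pcompose_in_poly_in_power by metis
qed

lemma residue_class_decomposition:
  fixes f :: "'a::comm_ring_1 poly"
  shows "\<exists>g. (\<forall>i. g i \<in> poly_in_power (Suc m)) \<and> f = (\<Sum>i<Suc m. [:0, 1:] ^ i * g i)"
proof (induction f)
  case 0
  show ?case
    by (rule exI[of _ "\<lambda>_. 0"]) (simp add: zero_in_poly_in_power)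
next
  case (pCons a q)
  then obtain g where g: "\<And>i. g i \<in> poly_in_power (Suc m)"
    and q: "q = (\<Sum>i<Suc m. [:0, 1:] ^ i * g i)"
    by blast
  \<comment> \<open>Multiplication by the variable raises every exponent by one, and the top exponent
      wraps around to the class of \<open>0\<close>.\<close>
  define h where "h i = (case i of 0 \<Rightarrow> [:a:] + [:0, 1:] ^ Suc m * g m | Suc j \<Rightarrow> g j)" for i
  have "h i \<in> poly_in_power (Suc m)" for i
    unfolding h_def by (cases i) (simp_all only: nat.case g pCons_power_in_poly_in_power)
  moreover have "pCons a q = (\<Sum>i<Suc m. [:0, 1:] ^ i * h i)"
  proof -
    have "pCons a q = [:a:] + [:0, 1:] * q"
      by simp
    also have "\<dots> = [:a:] + [:0, 1:] ^ Suc m * g m + (\<Sum>i<m. [:0, 1:] ^ Suc i * g i)"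
      unfolding q by (simp only: sum.lessThan_Suc distrib_left sum_distrib_left power_Suc ac_simps)
    also have "\<dots> = (\<Sum>i<Suc m. [:0, 1:] ^ i * h i)"
      unfolding sum.lessThan_Suc_shift h_def by (simp only: nat.case power_0 mult_1)
    finally show ?thesis .
  qed
  ultimately show ?case
    by blast
qed

section \<open>Derivatives in positive characteristic\<close>

lemma pderiv_poly_in_power_CHAR:
  fixes g :: "'a::idom poly"
  assumes "g \<in> poly_in_power CHAR('a)"
  shows "pderiv g = 0"
proof -
  have "pderiv ([:0, 1:] ^ CHAR('a) :: 'a poly) = 0"
    by (simp add: pderiv_power)
  then show ?thesis
    using assms unfolding poly_in_power_def by (auto simp: pderiv_pcompose)
qed

lemma higher_pderiv_pCons:
  "(pderiv ^^ Suc n) (pCons a q) = of_nat (Suc n) * (pderiv ^^ n) q + [:0, 1:] * (pderiv ^^ Suc n) q"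
  by (induction n) (simp_all add: pderiv_pCons pderiv_add pderiv_mult algebra_simps)

text \<open>
  In the product rule for \<open>\<partial>\<^sup>n (a + X q)\<close> the only term not covered by induction is
  \<open>n \<partial>\<^sup>n\<^sup>-\<^sup>1 q\<close>, which vanishes when \<open>n\<close> is the characteristic.
\<close>
lemma higher_pderiv_CHAR:
  fixes a :: "'a::idom poly"
  assumes "CHAR('a) = Suc n"
  shows "(pderiv ^^ Suc n) a = 0"
proof (induction a)
  case 0
  show ?case by (rule higher_pderiv_0)
next
  case (pCons c q)
  have "of_nat (Suc n) = (0 :: 'a poly)"
    by (metis semiring_char_poly assms of_nat_CHAR)
  then show ?case
    using pCons.IH by (simp only: higher_pderiv_pCons) simp
qed

section \<open>Powers of the derivation\<close>

text \<open>
  Since \<open>c\<close> is a constant, \<open>D\<^sup>n\<^sup>+\<^sup>1 = c D\<close> iterates to \<open>D\<^sup>k\<^sup>n\<^sup>+\<^sup>1 = c\<^sup>k D\<close>; at the variable the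
  right side is \<open>c\<^sup>k f\<close>, which is nonzero in a domain unless \<open>c\<close> or \<open>f\<close> is zero.
\<close>
lemma locally_nilpotent_iff_factor_zero:
  fixes f c :: "'a::idom poly" and n :: nat
  defines "D \<equiv> (\<lambda>a. f * pderiv a)"
  assumes "f \<noteq> 0" and c: "pderiv c = 0"
    and n: "n > 0" and pow: "\<And>a. (D ^^ Suc n) a = c * D a"
  shows "locally_nilpotent D \<longleftrightarrow> c = 0"
proof
  assume "c = 0"
  then show "locally_nilpotent D"
    unfolding locally_nilpotent_def using pow by (metis le_add1 mult_zero_left plus_1_eq_Suc)
next
  assume nil: "locally_nilpotent D"
  have D_mult: "D (c ^ k * b) = c ^ k * D b" for k b
    unfolding D_def by (simp add: pderiv_mult pderiv_power c)
  have iter: "(D ^^ Suc (n * k)) a = c ^ k * D a" for k a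
  proof (induction k)
    case 0
    show ?case by simp
  next
    case (Suc k)
    have D_mult_iter: "(D ^^ j) (c ^ k * b) = c ^ k * (D ^^ j) b" for j b
      by (induction j) (simp_all add: D_mult)
    have "(D ^^ Suc (n * Suc k)) a = (D ^^ n) ((D ^^ Suc (n * k)) a)"
      by (metis add_Suc_right comp_apply funpow_add mult_Suc_right)
    also have "\<dots> = c ^ k * (D ^^ Suc n) a"
      unfolding Suc.IH D_mult_iter by (simp only: funpow_Suc_right comp_apply)
    finally show ?case
      using pow by (simp add: algebra_simps)
  qed
  obtain m where m: "(D ^^ m) [:0, 1:] = 0"
    using nil unfolding locally_nilpotent_def by blast
  have D0: "(D ^^ j) 0 = 0" for j
    by (induction j) (simp_all add: D_def)
  have "m \<le> Suc (n * m)"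
    using n by (cases n) auto
  then obtain j where "Suc (n * m) = j + m"
    using le_Suc_ex by (metis add.commute)
  then have "(D ^^ Suc (n * m)) [:0, 1:] = 0"
    by (simp only: funpow_add comp_apply m D0)
  then have "c ^ m * f = 0"
    unfolding iter by (simp add: D_def pderiv_pCons)
  then show "c = 0"
    using \<open>f \<noteq> 0\<close> by simp
qed

lemma derivation_square_char_2:
  fixes f0 f1 :: "'a::idom poly"
  assumes char: "CHAR('a) = 2"
    and const: "pderiv f0 = 0" "pderiv f1 = 0"
    and f: "f = f0 + [:0, 1:] * f1"
  shows "((\<lambda>a. f * pderiv a) ^^ Suc 1) a = f1 * (f * pderiv a)"
proof -
  have "pderiv (pderiv a) = 0"
    using higher_pderiv_CHAR[of 1 a] char by simp
  moreover have "pderiv f = f1"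
    unfolding f by (simp add: pderiv_add pderiv_mult pderiv_pCons const)
  ultimately show ?thesis
    by (simp add: pderiv_mult algebra_simps)
qed

text \<open>
  The product rule gives \<open>D\<^sup>3 = f (f'\<^sup>2 + f f'') \<partial> + 3 f\<^sup>2 f' \<partial>\<^sup>2 + f\<^sup>3 \<partial>\<^sup>3\<close>, where the last two
  terms vanish in characteristic \<open>3\<close>, and in \<open>f'\<^sup>2 + f f''\<close> every term containing the variable
  has a coefficient divisible by \<open>3\<close>.
\<close>
lemma derivation_cube_char_3:
  fixes f0 f1 f2 :: "'a::idom poly"
  assumes char: "CHAR('a) = 3"
    and const: "pderiv f0 = 0" "pderiv f1 = 0" "pderiv f2 = 0"
    and f: "f = [:0, 1:] ^ 2 * f2 + [:0, 1:] * f1 + f0"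
  shows "((\<lambda>a. f * pderiv a) ^^ Suc 2) a = (f1 ^ 2 - f2 * f0) * (f * pderiv a)"
proof -
  define X :: "'a poly" where "X = [:0, 1:]"
  have X: "pderiv X = 1"
    by (simp add: X_def pderiv_pCons)
  have three: "3 = (0 :: 'a poly)"
    by (metis semiring_char_poly char of_nat_CHAR of_nat_numeral)
  have a3: "pderiv (pderiv (pderiv a)) = 0"
    using higher_pderiv_CHAR[of 2 a] char by (simp add: numeral_2_eq_2)
  have f': "pderiv f = 2 * X * f2 + f1"
    unfolding f X_def[symmetric]
    by (simp add: pderiv_add pderiv_mult X const power2_eq_square algebra_simps)
  have f'': "pderiv (pderiv f) = 2 * f2"
    unfolding f' by (simp add: pderiv_add pderiv_mult X const)
  have quadratic: "pderiv f ^ 2 + f * pderiv (pderiv f) = f1 ^ 2 - f2 * f0"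
  proof -
    have "pderiv f ^ 2 + f * pderiv (pderiv f)
        = f1 ^ 2 - f2 * f0 + 3 * (2 * X ^ 2 * f2 ^ 2 + 2 * X * f1 * f2 + f2 * f0)"
      unfolding f'' unfolding f' unfolding f X_def[symmetric] by algebra
    then show ?thesis
      by (simp add: three)
  qed
  have "((\<lambda>a. f * pderiv a) ^^ Suc 2) a
      = (pderiv f ^ 2 + f * pderiv (pderiv f)) * (f * pderiv a)
        + 3 * (f ^ 2 * pderiv f * pderiv (pderiv a)) + f ^ 3 * pderiv (pderiv (pderiv a))"
    by (simp add: numeral_2_eq_2 numeral_3_eq_3 pderiv_mult pderiv_add algebra_simps)
  then show ?thesis
    unfolding quadratic by (simp add: three a3)
qed

section \<open>Local nilpotency in terms of the components\<close>

lemma locally_nilpotent_char_2: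
  fixes f :: "'a::idom poly"
  assumes char: "CHAR('a) = 2" and "f \<noteq> 0"
  shows "locally_nilpotent (\<lambda>a. f * pderiv a) \<longleftrightarrow> f \<in> poly_in_power 2"
proof -
  have const: "pderiv g = 0" if "g \<in> poly_in_power 2" for g :: "'a poly"
    using pderiv_poly_in_power_CHAR that char by metis
  have crit: "locally_nilpotent (\<lambda>a. f * pderiv a) \<longleftrightarrow> f1 = 0"
    if "f0 \<in> poly_in_power 2" "f1 \<in> poly_in_power 2" "f = f0 + [:0, 1:] * f1" for f0 f1
    using derivation_square_char_2[OF char const const, OF that] const[OF that(2)] \<open>f \<noteq> 0\<close>
    by (intro locally_nilpotent_iff_factor_zero[where n = 1]) simp_all
  obtain g where g: "\<And>i. g i \<in> poly_in_power 2" and "f = (\<Sum>i<2. [:0, 1:] ^ i * g i)"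
    using residue_class_decomposition[of 1 f] by (auto simp: numeral_2_eq_2)
  then have f: "f = g 0 + [:0, 1:] * g 1"
    by (simp add: numeral_2_eq_2)
  show ?thesis
  proof
    assume "locally_nilpotent (\<lambda>a. f * pderiv a)"
    then have "g 1 = 0"
      using crit[OF g g f] by blast
    then show "f \<in> poly_in_power 2"
      using f g[of 0] by simp
  next
    assume "f \<in> poly_in_power 2"
    then show "locally_nilpotent (\<lambda>a. f * pderiv a)"
      using crit[of f 0] zero_in_poly_in_power[of 2] by simp
  qed
qed

lemma locally_nilpotent_char_3:
  fixes f f0 f1 f2 :: "'a::idom poly"
  assumes char: "CHAR('a) = 3" and "f \<noteq> 0"
    and "f0 \<in> poly_in_power 3" "f1 \<in> poly_in_power 3" "f2 \<in> poly_in_power 3"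
    and f: "f = [:0, 1:] ^ 2 * f2 + [:0, 1:] * f1 + f0"
  shows "locally_nilpotent (\<lambda>a. f * pderiv a) \<longleftrightarrow> f2 * f0 = f1 ^ 2"
proof -
  have const: "pderiv f0 = 0" "pderiv f1 = 0" "pderiv f2 = 0"
    using assms(3-5) pderiv_poly_in_power_CHAR char by metis+
  have "pderiv (f1 ^ 2 - f2 * f0) = 0"
    by (simp add: const pderiv_diff pderiv_mult power2_eq_square)
  then have "locally_nilpotent (\<lambda>a. f * pderiv a) \<longleftrightarrow> f1 ^ 2 - f2 * f0 = 0"
    using derivation_cube_char_3[OF char const f] \<open>f \<noteq> 0\<close>
    by (intro locally_nilpotent_iff_factor_zero[where n = 2]) simp_all
  then show ?thesis
    by auto
qed

theorem theorem3p6: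
  fixes f :: "'a::idom poly" and D :: "'a poly \<Rightarrow> 'a poly" and p :: nat
  assumes "CHAR('a) = p"
    and "p \<in> {2, 3}"
    and "D = (\<lambda>a. f * pderiv a)"
    and "D \<noteq> (\<lambda>a. 0)"
  shows "locally_nilpotent D \<longleftrightarrow>
    (\<exists>r\<in>{0..p - 1}. r \<noteq> 1 \<and> (\<exists>g\<in>poly_in_power p. f = [:0, 1:] ^ r * g)) \<or>
    (p = 3 \<and> (\<exists>f2\<in>poly_in_power 3. \<exists>f1\<in>poly_in_power 3. \<exists>f0\<in>poly_in_power 3.
      f = [:0, 1:] ^ 2 * f2 + [:0, 1:] * f1 + f0 \<and>
      f2 * f1 * f0 \<noteq> 0 \<and> f2 * f0 = f1 ^ 2))"
    (is "_ \<longleftrightarrow> ?i \<or> ?ii")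
proof -
  have f_nz: "f \<noteq> 0"
    using assms(3,4) by auto
  consider "p = 2" | "p = 3"
    using assms(2) by blast
  then show ?thesis
  proof cases
    case 1
    have "{0..p - 1} = {0, 1}"
      using 1 by auto
    then have "?i \<longleftrightarrow> f \<in> poly_in_power 2"
      using 1 by auto
    then show ?thesis
      using locally_nilpotent_char_2[OF _ f_nz] assms 1 by simp
  next
    case 2
    then have char: "CHAR('a) = 3"
      using assms by simp
    note crit = locally_nilpotent_char_3[OF char f_nz]
    have "{0..p - 1} = {0, 1, 2}"
      using 2 by auto
    then have i: "?i \<longleftrightarrow> (\<exists>g\<in>poly_in_power 3. f = g) \<or> (\<exists>g\<in>poly_in_power 3. f = [:0, 1:] ^ 2 * g)"
      using 2 by simp
    show ?thesis
    proof
      assume nil: "locally_nilpotent D"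
      obtain g where g: "\<And>i. g i \<in> poly_in_power 3" and "f = (\<Sum>i<3. [:0, 1:] ^ i * g i)"
        using residue_class_decomposition[of 2 f] by (auto simp: numeral_3_eq_3)
      then have f: "f = [:0, 1:] ^ 2 * g 2 + [:0, 1:] * g 1 + g 0"
        by (simp add: numeral_3_eq_3 numeral_2_eq_2)
      have eq: "g 2 * g 0 = g 1 ^ 2"
        using crit[OF g g g f] nil assms(3) by blast
      show "?i \<or> ?ii"
      proof (cases "g 2 * g 1 * g 0 = 0")
        case True
        then have "g 1 = 0" and "g 2 = 0 \<or> g 0 = 0"
          using eq by auto
        then have "f = g 0 \<or> f = [:0, 1:] ^ 2 * g 2"
          using f by auto
        then show ?thesis
          unfolding i using g by blast
      next
        case False
        then show ?thesis
          using 2 f g eq by blast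
      qed
    next
      assume "?i \<or> ?ii"
      then consider g where "g \<in> poly_in_power 3" "f = g"
        | g where "g \<in> poly_in_power 3" "f = [:0, 1:] ^ 2 * g"
        | f2 f1 f0 where "f2 \<in> poly_in_power 3" "f1 \<in> poly_in_power 3" "f0 \<in> poly_in_power 3"
            "f = [:0, 1:] ^ 2 * f2 + [:0, 1:] * f1 + f0" "f2 * f0 = f1 ^ 2"
        unfolding i by blast
      then show "locally_nilpotent D"
      proof cases
        case 1
        then show ?thesis
          using crit[of g 0 0] zero_in_poly_in_power[of 3] assms(3) by simp
      next
        case 2
        then show ?thesis
          using crit[of 0 0 g] zero_in_poly_in_power[of 3] assms(3) by simp
      next
        case 3
        then show ?thesis
          using crit assms(3) by blast
      qed
    qed
  qed
qed

end
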